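(* Let $n\ge 1$, let $\mathscr{A},\mathscr{B}\subseteq\mathbb{N}^n$ be finite sets, let $\gamma\in\mathbb{N}^n$, and let $c_{\alpha}>0$ for $\alpha\in\mathscr{A}$ and $d_{\beta}>0$ for $\beta\in\mathscr{B}$ be real numbers. Let $\Delta=\mathrm{conv}(\mathscr{A}\cup\{\gamma\})$ and suppose $\mathscr{B}\subseteq\Delta^{\circ}\cap\mathbb{N}^n$. Assume that $\dim(\Delta)=n$, that $\Delta$ is simple at some vertex, and that $\sum_{\alpha\in\mathscr{A}}c_{\alpha}\mathbf{x}^{\alpha}-\sum_{\beta\in\mathscr{B}}d_{\beta}\mathbf{x}^{\beta}$ is not nonnegative over $\mathbb{R}_{+}^n$. Then the system of $n$ polynomial equations (written as one vector equation in $\mathbb{R}^n$) $$\sum_{\alpha\in\mathscr{A}}c_{\alpha}(\alpha-\gamma)\mathbf{x}^{\alpha}-\sum_{\beta\in\mathscr{B}}d_{\beta}(\beta-\gamma)\mathbf{x}^{\beta}=\mathbf{0}$$ has at least one positive real zero, i.e. a solution $\mathbf{x}\in\mathbb{R}_+^n$.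
   Context: $\mathbb{N}=\{0,1,2,\ldots\}$; $\mathbb{R}_+$ is the set of (strictly) positive real numbers. For $\alpha=(\alpha_1,\ldots,\alpha_n)$, $\mathbf{x}^{\alpha}=x_1^{\alpha_1}\cdots x_n^{\alpha_n}$. $\mathrm{conv}$ denotes convex hull, and for a polytope $P$, $P^{\circ}$ denotes its interior. A polynomial $g$ is nonnegative over a set $A\subseteq\mathbb{R}^n$ if $g(\mathbf{x})\ge 0$ for all $\mathbf{x}\in A$. A polytope $\Delta$ of dimension $d$ is called simple at a vertex $v$ of $\Delta$ if $v$ is the intersection of precisely $d$ edges of $\Delta$ (i.e. exactly $d$ edges of $\Delta$ contain $v$). *)

theory Defs
  imports "HOL-Analysis.Analysis"
begin

text \<open>Exponent vectors in \<open>\<nat>\<^sup>n\<close> have type \<open>nat ^ 'n\<close>; this is their inclusion into \<open>\<real>\<^sup>n\<close>.\<close>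

definition rvec :: "nat ^ 'n \<Rightarrow> real ^ 'n" where
  "rvec a = (\<chi> i. real (a $ i))"

definition monomial :: "real ^ 'n \<Rightarrow> nat ^ 'n \<Rightarrow> real" where
  "monomial x a = (\<Prod>i\<in>UNIV. (x $ i) ^ (a $ i))"

definition pos_orthant :: "(real ^ 'n) set" where
  "pos_orthant = {x. \<forall>i. 0 < x $ i}"

definition nonneg_over :: "(real ^ 'n \<Rightarrow> real) \<Rightarrow> (real ^ 'n) set \<Rightarrow> bool" where
  "nonneg_over g S \<longleftrightarrow> (\<forall>x\<in>S. 0 \<le> g x)"

text \<open>Intended for polytopes, which have only finitely many edges. A one-dimensional
  polytope is an edge of itself (\<open>edge_of\<close> admits the improper face), so segments are
  simple at both endpoints.\<close>

definition simple_at_vertex :: "'a::euclidean_space set \<Rightarrow> 'a \<Rightarrow> bool" where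
  "simple_at_vertex P v \<longleftrightarrow>
     v extreme_point_of P \<and> int (card {e. e edge_of P \<and> v \<in> e}) = aff_dim P"

end

theory Submission
  imports Defs
begin

text \<open>
  Substitute \<open>x = exp y\<close> coordinatewise and divide by \<open>x\<^sup>\<gamma>\<close>. The polynomial turns into
  the exponential sum
  \<open>F y = (\<Sum>\<alpha>\<in>A. c\<^sub>\<alpha> exp ((\<alpha> - \<gamma>) \<bullet> y)) - (\<Sum>\<beta>\<in>B. d\<^sub>\<beta> exp ((\<beta> - \<gamma>) \<bullet> y))\<close>
  on all of \<open>\<real>\<^sup>n\<close>, and the left-hand side of the system is a positive multiple of the gradient
  of \<open>F\<close>. It is therefore enough that \<open>F\<close> has a global minimum.

  Let \<open>h y \<ge> 0\<close> be the maximum of \<open>0\<close> and all \<open>(\<alpha> - \<gamma>) \<bullet> y\<close>, that is, the support function of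
  \<open>\<Delta> - \<gamma>\<close>. Each \<open>\<beta>\<close> is an interior point of \<open>\<Delta>\<close>, so \<open>(\<beta> - \<gamma>) \<bullet> y \<le> h y - \<epsilon> \<parallel>y\<parallel>\<close> for some
  \<open>\<epsilon> > 0\<close> (lemma \<open>interior_convex_hull_support_gap\<close>). The negative terms thus add up to at most
  \<open>exp (h y) * T \<parallel>y\<parallel>\<close>, where \<open>T\<close> tends to \<open>0\<close>. If \<open>h y\<close> is one of the \<open>(\<alpha> - \<gamma>) \<bullet> y\<close>, the
  \<open>\<alpha>\<close>-term outweighs them once \<open>T \<parallel>y\<parallel> < c\<^sub>\<alpha>\<close>; otherwise \<open>h y = 0\<close> and \<open>F y \<ge> - T \<parallel>y\<parallel>\<close>. So the
  lower limit of \<open>F\<close> at infinity is nonnegative. As \<open>F\<close> takes a negative value, its minimum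
  over a large ball is a global one (lemma \<open>exp_sum_critical_point\<close>).
\<close>

text \<open>
  The functional \<open>y\<close> is bounded by \<open>t\<close> on the convex hull and therefore on a ball around \<open>q\<close>;
  for \<open>y \<noteq> 0\<close>, the bound at the boundary point \<open>q + e y / \<parallel>y\<parallel>\<close> of that ball gives the gap \<open>e \<parallel>y\<parallel>\<close>, with \<open>e\<close>
  independent of \<open>y\<close>.
\<close>

lemma interior_convex_hull_support_gap:
  fixes q :: "'a::euclidean_space"
  assumes "q \<in> interior (convex hull S)"
  obtains e where "e > 0"
    and "\<And>y t. (\<And>s. s \<in> S \<Longrightarrow> s \<bullet> y \<le> t) \<Longrightarrow> q \<bullet> y + e * norm y \<le> t"
proof -
  from assms obtain e where e: "e > 0" "cball q e \<subseteq> convex hull S"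
    by (auto simp: mem_interior_cball)
  show thesis
  proof
    fix y t
    assume "\<And>s. s \<in> S \<Longrightarrow> s \<bullet> y \<le> t"
    then have hull: "convex hull S \<subseteq> {w. y \<bullet> w \<le> t}"
      by (intro hull_minimal convex_halfspace_le) (auto simp: inner_commute)
    have "q + e *\<^sub>R sgn y \<in> cball q e"
      using e(1) by (simp add: dist_norm norm_sgn)
    then have "y \<bullet> (q + e *\<^sub>R sgn y) \<le> t"
      using e(2) hull by blast
    moreover have "y \<bullet> sgn y = norm y"
      by (cases "y = 0") (simp_all add: sgn_div_norm dot_square_norm power2_eq_square)
    ultimately show "q \<bullet> y + e * norm y \<le> t"
      by (simp add: inner_add_right inner_commute)
  qed (fact e(1))
qed

text \<open>
  The origin is adjoined to the exponents but need not be one of them, and it may lie on the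
  boundary of the hull. Then the exponential sum need not be coercive, and some condition such as the negative
  value is needed: on the real line, \<open>exp y\<close> has no critical point.
\<close>

lemma exp_sum_critical_point:
  fixes v :: "'i \<Rightarrow> 'a::euclidean_space"
  assumes A: "finite A" "\<And>a. a \<in> A \<Longrightarrow> c a > 0"
    and B: "finite B" "\<And>b. b \<in> B \<Longrightarrow> d b \<ge> 0"
    and int: "v ` B \<subseteq> interior (convex hull (insert 0 (v ` A)))"
    and neg: "(\<Sum>a\<in>A. c a * exp (v a \<bullet> y0)) - (\<Sum>b\<in>B. d b * exp (v b \<bullet> y0)) < 0"
  shows "\<exists>y. (\<Sum>a\<in>A. (c a * exp (v a \<bullet> y)) *\<^sub>R v a) - (\<Sum>b\<in>B. (d b * exp (v b \<bullet> y)) *\<^sub>R v b) = 0"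
proof -
  define F where "F y = (\<Sum>a\<in>A. c a * exp (v a \<bullet> y)) - (\<Sum>b\<in>B. d b * exp (v b \<bullet> y))" for y
  have "\<exists>e>0. \<forall>y t. (\<forall>s\<in>insert 0 (v ` A). s \<bullet> y \<le> t) \<longrightarrow> v b \<bullet> y + e * norm y \<le> t" if "b \<in> B" for b
    using interior_convex_hull_support_gap[of "v b" "insert 0 (v ` A)"] int that
    by (metis image_subset_iff)
  then obtain e where e: "\<And>b. b \<in> B \<Longrightarrow> e b > 0"
    and gap: "\<And>b y t. b \<in> B \<Longrightarrow> (\<And>s. s \<in> insert 0 (v ` A) \<Longrightarrow> s \<bullet> y \<le> t)
                \<Longrightarrow> v b \<bullet> y + e b * norm y \<le> t"
    by metis
  define T where "T r = (\<Sum>b\<in>B. d b * exp (- (e b * r)))" for r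
  have "((\<lambda>r. \<Sum>b\<in>B. d b * exp (- (e b * r))) \<longlongrightarrow> (\<Sum>b\<in>B. d b * 0)) at_top"
    by (intro tendsto_intros filterlim_compose[OF exp_at_bot]
        filterlim_compose[OF filterlim_uminus_at_bot_at_top]
        filterlim_tendsto_pos_mult_at_top[OF tendsto_const] filterlim_ident e)
  then have T0: "(T \<longlongrightarrow> 0) at_top"
    by (simp add: T_def[abs_def])
  have "\<forall>\<^sub>F r in at_top. (\<forall>a\<in>A. T r < c a) \<and> T r < - F y0"
    using neg by (intro eventually_conj eventually_ball_finite ballI order_tendstoD(2)[OF T0] A)
      (auto simp: F_def)
  then obtain R where R: "\<And>r a. r \<ge> R \<Longrightarrow> a \<in> A \<Longrightarrow> T r < c a" "\<And>r. r \<ge> R \<Longrightarrow> T r < - F y0"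
    by (auto simp: eventually_at_top_linorder)
  have far: "F y0 \<le> F y" if y: "norm y \<ge> R" for y
  proof -
    \<comment> \<open>support function of the hull\<close>
    define h where "h = Max ((\<lambda>s. s \<bullet> y) ` insert 0 (v ` A))"
    have h: "s \<bullet> y \<le> h" if "s \<in> insert 0 (v ` A)" for s
      unfolding h_def using that A(1) by (intro Max_ge) auto
    have "d b * exp (v b \<bullet> y) \<le> exp h * (d b * exp (- (e b * norm y)))" if "b \<in> B" for b
    proof -
      have "v b \<bullet> y \<le> h - e b * norm y"
        using gap[OF that h] by simp
      then have "exp (v b \<bullet> y) \<le> exp h * exp (- (e b * norm y))"
        by (simp flip: exp_add)
      from mult_left_mono[OF this B(2)[OF that]] show ?thesis
        by (simp only: mult.left_commute)
    qed
    then have "(\<Sum>b\<in>B. d b * exp (v b \<bullet> y)) \<le> exp h * T (norm y)"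
      unfolding T_def sum_distrib_left by (intro sum_mono)
    then have F_ge: "F y \<ge> (\<Sum>a\<in>A. c a * exp (v a \<bullet> y)) - exp h * T (norm y)"
      by (simp add: F_def)
    have "h \<in> (\<lambda>s. s \<bullet> y) ` insert 0 (v ` A)"
      unfolding h_def using A(1) by (intro Max_in) auto
    then consider a where "a \<in> A" "h = v a \<bullet> y" | "h = 0"
      by auto
    then show ?thesis
    proof cases
      case 1
      have "exp h * T (norm y) \<le> c a * exp (v a \<bullet> y)"
        using R(1)[OF y 1(1)] 1(2) by simp
      also have "\<dots> \<le> (\<Sum>a\<in>A. c a * exp (v a \<bullet> y))"
        using A 1(1) by (intro member_le_sum) (auto intro: less_imp_le)
      finally have "F y \<ge> 0"
        using F_ge by simp
      then show ?thesis
        using neg by (simp add: F_def)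
    next
      case 2
      have "(\<Sum>a\<in>A. c a * exp (v a \<bullet> y)) \<ge> 0"
        using A(2) by (intro sum_nonneg) (auto intro: less_imp_le)
      then show ?thesis
        using F_ge R(2)[OF y] 2 by simp
    qed
  qed
  have cont: "continuous_on (cball 0 (max R (norm y0))) F"
    unfolding F_def by (intro continuous_intros)
  have "cball 0 (max R (norm y0)) \<noteq> ({} :: 'a set)"
    by (auto simp: le_max_iff_disj)
  then obtain z where z: "\<And>y. norm y \<le> max R (norm y0) \<Longrightarrow> F z \<le> F y"
    using continuous_attains_inf[OF compact_cball _ cont] by (metis mem_cball_0)
  \<comment> \<open>Outside the ball \<open>far\<close> compares with \<open>y0\<close>, which the radius \<open>max R \<parallel>y0\<parallel>\<close> puts inside it.\<close>
  have min: "F z \<le> F y" for y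
    using z[of y] z[of y0] far[of y] by fastforce
  define G where "G = (\<Sum>a\<in>A. (c a * exp (v a \<bullet> z)) *\<^sub>R v a) - (\<Sum>b\<in>B. (d b * exp (v b \<bullet> z)) *\<^sub>R v b)"
  have "(F has_derivative (\<lambda>w. G \<bullet> w)) (at z)"
    unfolding F_def G_def
    by (auto intro!: derivative_eq_intros sum.cong
        simp: inner_diff_left inner_sum_left algebra_simps)
  then have "(\<lambda>w. G \<bullet> w) = (\<lambda>w. 0)"
    by (rule has_derivative_local_min) (simp add: min)
  then have "G \<bullet> G = 0"
    by meson
  then show ?thesis
    by (auto simp: G_def)
qed

lemma monomial_exp:
  "monomial (\<chi> i. exp (y $ i)) a = exp (rvec a \<bullet> y)"
  by (simp add: monomial_def rvec_def inner_vec_def exp_sum flip: exp_of_nat_mult)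

theorem theorem4p6:
  fixes A B :: "(nat ^ 'n) set"
    and \<gamma> :: "nat ^ 'n"
    and c d :: "nat ^ 'n \<Rightarrow> real"
    and \<Delta> :: "(real ^ 'n) set"
  assumes "finite A" and "finite B"
    and "\<And>\<alpha>. \<alpha> \<in> A \<Longrightarrow> c \<alpha> > 0"
    and "\<And>\<beta>. \<beta> \<in> B \<Longrightarrow> d \<beta> > 0"
    and "\<Delta> = convex hull (rvec ` (A \<union> {\<gamma>}))"
    and "rvec ` B \<subseteq> interior \<Delta>"
    and "aff_dim \<Delta> = int CARD('n)"
    and "\<exists>v. simple_at_vertex \<Delta> v"
    and "\<not> nonneg_over
           (\<lambda>x. (\<Sum>\<alpha>\<in>A. c \<alpha> * monomial x \<alpha>) - (\<Sum>\<beta>\<in>B. d \<beta> * monomial x \<beta>)) pos_orthant"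
  shows "\<exists>x \<in> pos_orthant.
           (\<Sum>\<alpha>\<in>A. (c \<alpha> * monomial x \<alpha>) *\<^sub>R (rvec \<alpha> - rvec \<gamma>))
           - (\<Sum>\<beta>\<in>B. (d \<beta> * monomial x \<beta>) *\<^sub>R (rvec \<beta> - rvec \<gamma>)) = 0"
proof -
  define v where "v a = rvec a - rvec \<gamma>" for a :: "nat ^ 'n"
  let ?e = "\<lambda>y :: real ^ 'n. \<chi> i. exp (y $ i)"
  have mono: "monomial (?e y) a = exp (rvec \<gamma> \<bullet> y) * exp (v a \<bullet> y)" for a y
    by (simp add: monomial_exp v_def inner_diff_left flip: exp_add)

  have "insert 0 (v ` A) = (\<lambda>x. - rvec \<gamma> + x) ` rvec ` (A \<union> {\<gamma>})"
    by (auto simp: v_def image_image)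
  then have "interior (convex hull (insert 0 (v ` A))) = (\<lambda>x. - rvec \<gamma> + x) ` interior \<Delta>"
    using assms(5) by (simp only: convex_hull_translation interior_translation)
  then have int: "v ` B \<subseteq> interior (convex hull (insert 0 (v ` A)))"
    using assms(6) by (auto simp: v_def)

  obtain x where x: "x \<in> pos_orthant"
    and neg: "(\<Sum>\<alpha>\<in>A. c \<alpha> * monomial x \<alpha>) - (\<Sum>\<beta>\<in>B. d \<beta> * monomial x \<beta>) < 0"
    using assms(9) by (auto simp: nonneg_over_def not_le)
  define y0 where "y0 = (\<chi> i. ln (x $ i))"
  have "x = ?e y0"
    using x by (simp add: y0_def vec_eq_iff pos_orthant_def)
  with neg have "exp (rvec \<gamma> \<bullet> y0) *
      ((\<Sum>\<alpha>\<in>A. c \<alpha> * exp (v \<alpha> \<bullet> y0)) - (\<Sum>\<beta>\<in>B. d \<beta> * exp (v \<beta> \<bullet> y0))) < 0"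
    by (simp add: mono sum_distrib_left right_diff_distrib mult_ac)
  then have neg': "(\<Sum>\<alpha>\<in>A. c \<alpha> * exp (v \<alpha> \<bullet> y0)) - (\<Sum>\<beta>\<in>B. d \<beta> * exp (v \<beta> \<bullet> y0)) < 0"
    by (simp add: mult_less_0_iff)

  obtain y where y: "(\<Sum>\<alpha>\<in>A. (c \<alpha> * exp (v \<alpha> \<bullet> y)) *\<^sub>R v \<alpha>) -
      (\<Sum>\<beta>\<in>B. (d \<beta> * exp (v \<beta> \<bullet> y)) *\<^sub>R v \<beta>) = 0"
    using exp_sum_critical_point[OF assms(1,3,2) less_imp_le[OF assms(4)] int neg'] by blast
  have "(\<Sum>\<alpha>\<in>A. (c \<alpha> * monomial (?e y) \<alpha>) *\<^sub>R (rvec \<alpha> - rvec \<gamma>)) -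
      (\<Sum>\<beta>\<in>B. (d \<beta> * monomial (?e y) \<beta>) *\<^sub>R (rvec \<beta> - rvec \<gamma>)) =
      exp (rvec \<gamma> \<bullet> y) *\<^sub>R ((\<Sum>\<alpha>\<in>A. (c \<alpha> * exp (v \<alpha> \<bullet> y)) *\<^sub>R v \<alpha>) -
      (\<Sum>\<beta>\<in>B. (d \<beta> * exp (v \<beta> \<bullet> y)) *\<^sub>R v \<beta>))"
    by (simp add: mono scaleR_right.sum scaleR_right_diff_distrib mult_ac flip: v_def)
  moreover have "?e y \<in> pos_orthant"
    by (simp add: pos_orthant_def)
  ultimately show ?thesis
    unfolding y by auto
qed

end
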